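(* Let $x\geq 2$ be an integer. For positive integers $m$ put $g_m(x):=2x(m-x-1)+1$ and $f_m(x):=\left\lfloor \binom{m}{2}/(x+1)\right\rfloor$. Then \[ \psi(m)\leq\begin{cases} g_{m}(x)-1 & \text{if } m\in\left\{ 4x^{2}-x,\dots,4x^{2}+3x-3\right\}, \\ g_{m}(x) & \text{if } m\in\left\{ 4x^{2}+3x-2,\,4x^{2}+3x-1\right\}, \\ f_{m}(x) & \text{if } m\in\left\{ 4x^{2}+3x,\dots,4(x+1)^{2}-(x+1)-1\right\}. \end{cases} \]
   Context: A vertex-colouring of a graph $G$ (not necessarily proper) is complete if for every pair of distinct colours used there are two adjacent vertices of $G$ carrying these two colours. The pseudoachromatic number $\psi(G)$ is the maximum number of colours in a complete vertex-colouring of $G$. For a positive integer $m$, $\psi(m):=\psi(L(K_m))$, where $L(K_m)$ is the line graph of the complete graph $K_m$. Equivalently, $\psi(m)$ is the maximum number of colours in an edge-colouring of $K_m$ (not necessarily proper) such that for every pair of distinct colours used there is a vertex of $K_m$ incident with edges of both colours. *)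

theory Defs
  imports Complex_Main
begin

text \<open>Simple graphs are pairs of a vertex set and a set of edges, an edge being a
  two-element set of vertices.\<close>

type_synonym 'a graph = "'a set \<times> 'a set set"

definition verts :: "'a graph \<Rightarrow> 'a set" where
  "verts G = fst G"

definition edges :: "'a graph \<Rightarrow> 'a set set" where
  "edges G = snd G"

definition complete_graph :: "nat \<Rightarrow> nat graph" where
  "complete_graph m = ({..<m}, {e. e \<subseteq> {..<m} \<and> card e = 2})"

definition line_graph :: "'a graph \<Rightarrow> 'a set graph" where
  "line_graph G =
     (edges G, {{e, f} | e f. e \<in> edges G \<and> f \<in> edges G \<and> e \<noteq> f \<and> e \<inter> f \<noteq> {}})"

text \<open>Colourings are not required to be proper, and the colours used are those in
  \<^term>\<open>c ` verts G\<close>; values of \<^term>\<open>c\<close> outside the vertex set are irrelevant.\<close>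

definition complete_colouring :: "'a graph \<Rightarrow> ('a \<Rightarrow> nat) \<Rightarrow> bool" where
  "complete_colouring G c \<longleftrightarrow>
     (\<forall>i \<in> c ` verts G. \<forall>j \<in> c ` verts G. i \<noteq> j \<longrightarrow>
        (\<exists>u \<in> verts G. \<exists>v \<in> verts G. {u, v} \<in> edges G \<and> c u = i \<and> c v = j))"

definition colour_numbers :: "'a graph \<Rightarrow> nat set" where
  "colour_numbers G = {card (c ` verts G) | c. complete_colouring G c}"

definition pseudoachromatic_number :: "'a graph \<Rightarrow> nat" where
  "pseudoachromatic_number G = Max (colour_numbers G)"

text \<open>The maximum is over a finite nonempty set whenever the graph is finite.\<close>

lemma finite_colour_numbers:
  assumes "finite (verts G)"
  shows "finite (colour_numbers G)"
proof (rule finite_subset)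
  show "colour_numbers G \<subseteq> {..card (verts G)}"
    using assms by (auto simp: colour_numbers_def intro: card_image_le)
qed simp

lemma colour_numbers_nonempty: "colour_numbers G \<noteq> {}"
proof -
  have "complete_colouring G (\<lambda>_. 0)"
    by (auto simp: complete_colouring_def)
  then show ?thesis
    by (auto simp: colour_numbers_def)
qed

definition \<psi> :: "nat \<Rightarrow> nat" where
  "\<psi> m = pseudoachromatic_number (line_graph (complete_graph m))"

text \<open>Integer-valued, so that no subtraction is truncated.\<close>

definition bound_g :: "nat \<Rightarrow> int \<Rightarrow> int" where
  "bound_g m x = 2 * x * (int m - x - 1) + 1"

definition bound_f :: "nat \<Rightarrow> int \<Rightarrow> int" where
  "bound_f m x = \<lfloor>real (m choose 2) / real_of_int (x + 1)\<rfloor>"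

end

theory Submission
  imports Defs
begin

text \<open>
  Fix a complete edge-colouring of \<open>K\<^sub>m\<close> with \<open>k\<close> colours. Two simple counts compete.

  \<^item> A colour class with \<open>s\<close> edges covers at most \<open>2s\<close> vertices, so at most \<open>2s(m-s-1)\<close> further
    edges touch it. Every other colour must occur among these, hence \<open>k \<le> g\<^sub>m(s)\<close>
    (\<open>num_colours_le_bound_g\<close>).

  \<^item> If all classes have more than \<open>x\<close> edges, then \<open>k (x+1) \<le> m choose 2\<close>, that is
    \<open>k \<le> f\<^sub>m(x)\<close>.

  Since \<open>g\<^sub>m\<close> increases in the relevant range, always \<open>k \<le> max (g\<^sub>m(x)) (f\<^sub>m(x))\<close>, and a
  comparison of two quadratics in \<open>m\<close> shows that \<open>g\<^sub>m(x)\<close> is the larger one for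
  \<open>4x\<^sup>2-x \<le> m \<le> 4x\<^sup>2+3x-1\<close> and \<open>f\<^sub>m(x)\<close> is at least as large from \<open>m = 4x\<^sup>2+3x\<close> on.

  Gaining one more for \<open>m \<le> 4x\<^sup>2+3x-3\<close> means excluding \<open>k = g\<^sub>m(x)\<close>. In that case the smallest
  classes have exactly \<open>x\<close> edges, and each of them is extremal for the first count: it covers
  exactly \<open>2x\<close> vertices, and the other edges touching it have pairwise distinct colours. Two
  extremal classes therefore share exactly one vertex (\<open>extremal_supports_meet_once\<close>). A family of
  \<open>2x\<close>-subsets of an \<open>m\<close>-set that pairwise share exactly one point has at most
  \<open>1 + 2x(2x+1)\<close> members here, because at most \<open>(m-1) / (2x-1) < 2x+3\<close> of them pass through a
  given point. But counting edges shows that at least \<open>k(x+1) - (m choose 2)\<close> classes have only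
  \<open>x\<close> edges, and for \<open>4x\<^sup>2-x \<le> m \<le> 4x\<^sup>2+3x-3\<close> this number is larger.
\<close>

section \<open>Families of sets that pairwise share one point\<close>

text \<open>Apart from the common point \<open>p\<close> the sets are disjoint.\<close>

lemma sets_through_point_bound:
  assumes "finite X" "finite I" "p \<in> X"
    and sub: "\<And>i. i \<in> I \<Longrightarrow> S i \<subseteq> X"
    and card: "\<And>i. i \<in> I \<Longrightarrow> card (S i) = n"
    and through: "\<And>i. i \<in> I \<Longrightarrow> p \<in> S i"
    and meet: "\<And>i j. i \<in> I \<Longrightarrow> j \<in> I \<Longrightarrow> i \<noteq> j \<Longrightarrow> card (S i \<inter> S j) = 1"
  shows "card I * (n - 1) \<le> card X - 1"
proof -
  have fin: "finite (S i)" if "i \<in> I" for i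
    using sub[OF that] \<open>finite X\<close> finite_subset by blast
  have disj: "(S i - {p}) \<inter> (S j - {p}) = {}" if "i \<in> I" "j \<in> I" "i \<noteq> j" for i j
  proof -
    have "card (S i \<inter> S j) = 1" using meet that by blast
    then obtain q where "S i \<inter> S j = {q}" using card_1_singletonE by blast
    moreover have "p \<in> S i \<inter> S j" using through that by blast
    ultimately have "S i \<inter> S j = {p}" by (metis singletonD)
    then show ?thesis by blast
  qed
  have "card I * (n - 1) = (\<Sum>i\<in>I. card (S i - {p}))"
    using card through by simp
  also have "\<dots> = card (\<Union>i\<in>I. S i - {p})"
    using \<open>finite I\<close> fin disj by (subst card_UN_disjoint) auto
  also have "\<dots> \<le> card (X - {p})"
    using sub \<open>finite X\<close> by (intro card_mono) auto
  finally show ?thesis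
    using \<open>p \<in> X\<close> by simp
qed

text \<open>All members other than a fixed \<open>S i\<close> pass through one of the \<open>n\<close> points of \<open>S i\<close>,
  and at most \<open>d\<close> members in addition to \<open>S i\<close> pass through each of these: \<open>d + 2\<close> members
  through one point would need \<open>(d + 2) (n - 1)\<close> further points.\<close>

lemma pairwise_one_point_family_bound:
  assumes "finite X" "finite I"
    and sub: "\<And>i. i \<in> I \<Longrightarrow> S i \<subseteq> X"
    and card: "\<And>i. i \<in> I \<Longrightarrow> card (S i) = n"
    and meet: "\<And>i j. i \<in> I \<Longrightarrow> j \<in> I \<Longrightarrow> i \<noteq> j \<Longrightarrow> card (S i \<inter> S j) = 1"
    and d: "card X - 1 < (d + 2) * (n - 1)"
  shows "card I \<le> 1 + n * d"
proof (cases "I = {}")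
  case False
  then obtain i where i: "i \<in> I" by blast
  define R where "R p = {j \<in> I - {i}. p \<in> S j}" for p
  have R: "card (R p) \<le> d" if p: "p \<in> S i" for p
  proof -
    have "card (insert i (R p)) * (n - 1) \<le> card X - 1"
      using sub i p card meet \<open>finite X\<close> \<open>finite I\<close>
      by (intro sets_through_point_bound[where p = p and S = S]) (auto simp: R_def)
    also have "\<dots> < (d + 2) * (n - 1)" by (rule d)
    finally have "card (insert i (R p)) < d + 2" by (simp only: mult_less_cancel2)
    then show ?thesis
      using \<open>finite I\<close> by (simp add: R_def)
  qed
  have "I - {i} \<subseteq> (\<Union>p\<in>S i. R p)"
  proof
    fix j assume j: "j \<in> I - {i}"
    then have "card (S i \<inter> S j) = 1" using meet i by blast
    then obtain p where "S i \<inter> S j = {p}" using card_1_singletonE by blast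
    then show "j \<in> (\<Union>p\<in>S i. R p)" using j by (auto simp: R_def)
  qed
  moreover have fS: "finite (S i)" using sub[OF i] \<open>finite X\<close> finite_subset by blast
  ultimately have "card (I - {i}) \<le> card (\<Union>p\<in>S i. R p)"
    using \<open>finite I\<close> by (intro card_mono) (auto simp: R_def)
  also have "\<dots> \<le> (\<Sum>p\<in>S i. card (R p))"
    by (rule card_UN_le[OF fS])
  also have "\<dots> \<le> n * d"
    using sum_bounded_above[of "S i" "\<lambda>p. card (R p)" d] R card[OF i] by simp
  finally show ?thesis
    using i \<open>finite I\<close> by (simp add: card_Diff_singleton)
qed simp

section \<open>Complete edge-colourings\<close>

definition pairs :: "nat \<Rightarrow> nat set set" where
  "pairs m = {e. e \<subseteq> {..<m} \<and> card e = 2}"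

lemma finite_pairs: "finite (pairs m)"
  by (rule finite_subset[of _ "Pow {..<m}"]) (auto simp: pairs_def)

lemma card_two_subsets: "finite V \<Longrightarrow> 2 * int (card {e. e \<subseteq> V \<and> card e = 2}) = int (card V) * (int (card V) - 1)"
proof -
  assume "finite V"
  then have "card {e. e \<subseteq> V \<and> card e = 2} = card V choose 2"
    by (rule n_subsets)
  moreover have "2 * int (n choose 2) = int n * (int n - 1)" for n
    by (induction n) (auto simp: numeral_2_eq_2 algebra_simps)
  ultimately show ?thesis by simp
qed

lemma card_pairs: "2 * int (card (pairs m)) = int m * (int m - 1)"
  using card_two_subsets[of "{..<m}"] by (simp add: pairs_def)

locale complete_edge_colouring =
  fixes m :: nat and c :: "nat set \<Rightarrow> nat"
  assumes complete: "i \<in> c ` pairs m \<Longrightarrow> j \<in> c ` pairs m \<Longrightarrow> i \<noteq> j \<Longrightarrow>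
    \<exists>e\<in>pairs m. \<exists>f\<in>pairs m. c e = i \<and> c f = j \<and> e \<inter> f \<noteq> {}"
begin

definition colours :: "nat set" where
  "colours = c ` pairs m"

definition colour_class :: "nat \<Rightarrow> nat set set" where
  "colour_class i = {e \<in> pairs m. c e = i}"

definition support :: "nat \<Rightarrow> nat set" where
  "support i = \<Union>(colour_class i)"

definition around :: "nat \<Rightarrow> nat set set" where
  "around i = {e \<in> pairs m. e \<inter> support i \<noteq> {}} - colour_class i"

lemma finite_colours: "finite colours"
  by (simp add: colours_def finite_pairs)

lemma finite_colour_class: "finite (colour_class i)"
  using finite_pairs by (simp add: colour_class_def)

lemma finite_around: "finite (around i)"
  using finite_pairs by (simp add: around_def)

lemma support_subset: "support i \<subseteq> {..<m}"
  by (auto simp: support_def colour_class_def pairs_def)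

lemma card_support_le: "card (support i) \<le> 2 * card (colour_class i)"
proof -
  have "card (support i) \<le> (\<Sum>e\<in>colour_class i. card e)"
    unfolding support_def by (rule card_Union_le_sum_card)
  also have "\<dots> = (\<Sum>e\<in>colour_class i. 2)"
    by (rule sum.cong) (auto simp: colour_class_def pairs_def)
  finally show ?thesis by simp
qed

text \<open>Counted by complement: the edges that miss the support lie within the other \<open>m - v\<close>
  vertices.\<close>

lemma card_around:
  fixes i defines "v \<equiv> int (card (support i))"
  shows "2 * int (card (around i)) = 2 * int m * v - v\<^sup>2 - v - 2 * int (card (colour_class i))"
proof -
  define D where "D = {e. e \<subseteq> {..<m} - support i \<and> card e = 2}"
  have fD: "finite D"
    unfolding D_def by (rule finite_subset[of _ "Pow {..<m}"]) auto
  have "card ({..<m} - support i) = m - card (support i)"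
    using support_subset finite_subset[OF support_subset] by (subst card_Diff_subset) auto
  moreover have "card (support i) \<le> m"
    using card_mono[OF _ support_subset] by simp
  ultimately have D: "2 * int (card D) = (int m - v) * (int m - v - 1)"
    using card_two_subsets[of "{..<m} - support i"] by (simp add: D_def v_def of_nat_diff)
  \<comment> \<open>Two-element sets are nonempty, so an edge of the class does touch the support.\<close>
  have nonempty: "e \<inter> support i \<noteq> {}" if "e \<in> colour_class i" for e
  proof -
    have "e \<noteq> {}" using that by (auto simp: colour_class_def pairs_def)
    moreover have "e \<subseteq> support i" using that by (auto simp: support_def)
    ultimately show ?thesis by blast
  qed
  have "pairs m = (around i \<union> colour_class i) \<union> D"
    using nonempty by (auto simp: around_def D_def pairs_def colour_class_def)
  moreover have "(around i \<union> colour_class i) \<inter> D = {}" "around i \<inter> colour_class i = {}"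
    using nonempty by (auto simp: around_def D_def)
  ultimately have "card (pairs m) = card (around i) + card (colour_class i) + card D"
    using finite_around finite_colour_class fD by (simp add: card_Un_disjoint)
  then show ?thesis
    using D card_pairs[of m] by (simp add: power2_eq_square algebra_simps)
qed

lemma other_colours_around:
  assumes "i \<in> colours"
  shows "colours - {i} \<subseteq> c ` around i"
proof
  fix j assume j: "j \<in> colours - {i}"
  then obtain e f where "e \<in> pairs m" "f \<in> pairs m" "c e = i" "c f = j" "e \<inter> f \<noteq> {}"
    using complete[of i j] assms by (auto simp: colours_def)
  with j have "f \<in> around i"
    by (auto simp: around_def support_def colour_class_def)
  with \<open>c f = j\<close> show "j \<in> c ` around i" by blast
qed

section \<open>A class of given size bounds the number of colours\<close>

text \<open>The number of edges around a class grows with the number \<open>v\<close> of covered vertices, so it is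
  largest at \<open>v = 2s\<close>, and only there. The third part records this for the equality case.\<close>

lemma around_bound:
  assumes i: "i \<in> colours" and small: "2 * card (colour_class i) < m"
  defines "s \<equiv> int (card (colour_class i))"
  shows "int (card colours) - 1 \<le> int (card (around i))"
    and "int (card (around i)) \<le> 2 * s * (int m - s - 1)"
    and "int (card (around i)) = 2 * s * (int m - s - 1) \<Longrightarrow>
      card (support i) = 2 * card (colour_class i)"
proof -
  have "card (colours - {i}) \<le> card (around i)"
    using surj_card_le[OF finite_around other_colours_around[OF i]] .
  then show "int (card colours) - 1 \<le> int (card (around i))"
    using i by (simp add: card_Diff_singleton)
  define v where "v = int (card (support i))"
  have v: "v \<le> 2 * s" using card_support_le[of i] by (simp add: v_def s_def)
  have pos: "0 < 2 * int m - 2 * s - v - 1" using v small by (simp add: s_def)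
  have eq: "2 * (2 * s * (int m - s - 1)) - 2 * int (card (around i))
      = (2 * s - v) * (2 * int m - 2 * s - v - 1)"
    using card_around[of i] by (simp add: v_def s_def power2_eq_square algebra_simps)
  have "0 \<le> (2 * s - v) * (2 * int m - 2 * s - v - 1)"
    using v pos by simp
  with eq show "int (card (around i)) \<le> 2 * s * (int m - s - 1)" by linarith
  assume "int (card (around i)) = 2 * s * (int m - s - 1)"
  with eq pos have "2 * s = v" by simp
  then show "card (support i) = 2 * card (colour_class i)"
    by (simp add: v_def s_def)
qed

lemma num_colours_le_bound_g:
  assumes "i \<in> colours" "2 * card (colour_class i) < m"
  shows "int (card colours) \<le> bound_g m (int (card (colour_class i)))"
  using around_bound(1,2)[OF assms] by (simp add: bound_g_def)

text \<open>With equality there are as many edges around the class as other colours, so no colour can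
  repeat among them.\<close>

lemma extremal_class:
  assumes i: "i \<in> colours" and small: "2 * card (colour_class i) < m"
    and eq: "int (card colours) = bound_g m (int (card (colour_class i)))"
  shows "card (support i) = 2 * card (colour_class i)" and "inj_on c (around i)"
proof -
  have around: "int (card (around i)) = int (card colours) - 1"
    using around_bound(1,2)[OF i small] eq by (simp add: bound_g_def)
  then show "card (support i) = 2 * card (colour_class i)"
    using around_bound(3)[OF i small] eq by (simp add: bound_g_def)
  have "int (card (colours - {i})) = int (card (around i))"
    using around i finite_colours by (simp add: card_gt_0_iff card_Diff_singleton of_nat_diff Suc_le_eq)
  moreover have "card (colours - {i}) \<le> card (c ` around i)"
    using other_colours_around[OF i] finite_around by (intro card_mono) auto
  ultimately have "card (c ` around i) = card (around i)"
    using card_image_le[OF finite_around[of i], of c] by linarith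
  then show "inj_on c (around i)"
    using eq_card_imp_inj_on finite_around by blast
qed

text \<open>Each colour has only one edge touching an extremal class of another colour. So if two common
  vertices existed, each of the two classes would contain the edge joining them, and
  an edge has only one colour.\<close>

lemma extremal_supports_meet_once:
  assumes ij: "i \<in> colours" "j \<in> colours" "i \<noteq> j"
    and inj: "inj_on c (around i)" "inj_on c (around j)"
  shows "card (support i \<inter> support j) = 1"
proof -
  have joining: "{u, v} \<in> colour_class b"
    if "inj_on c (around a)" "a \<noteq> b" "u \<noteq> v"
      "u \<in> support a" "u \<in> support b" "v \<in> support a" "v \<in> support b" for a b u v
  proof -
    from \<open>u \<in> support b\<close> obtain e where e: "e \<in> colour_class b" "u \<in> e"
      by (auto simp: support_def)
    from \<open>v \<in> support b\<close> obtain f where f: "f \<in> colour_class b" "v \<in> f"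
      by (auto simp: support_def)
    have "e \<in> around a" "f \<in> around a"
      using e f that by (auto simp: around_def colour_class_def)
    moreover have "c e = c f" using e f by (simp add: colour_class_def)
    ultimately have "e = f" using that(1) by (auto dest: inj_onD)
    then have "{u, v} \<subseteq> e" using e f by simp
    moreover have "card e = 2" using e by (simp add: colour_class_def pairs_def)
    ultimately have "e = {u, v}"
      using \<open>u \<noteq> v\<close> by (metis card_2_iff card_subset_eq card.infinite zero_neq_numeral)
    then show ?thesis using e by simp
  qed
  obtain e f where "e \<in> pairs m" "f \<in> pairs m" "c e = i" "c f = j" "e \<inter> f \<noteq> {}"
    using complete[of i j] ij by (auto simp: colours_def)
  then obtain p where p: "p \<in> support i" "p \<in> support j"
    by (auto simp: support_def colour_class_def)
  have "q = p" if q: "q \<in> support i" "q \<in> support j" for q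
  proof (rule ccontr)
    assume "q \<noteq> p"
    then have "{q, p} \<in> colour_class j" "{q, p} \<in> colour_class i"
      using joining[of i j q p] joining[of j i q p] inj ij p q by simp_all
    then show False using ij by (simp add: colour_class_def)
  qed
  then have "support i \<inter> support j = {p}" using p by blast
  then show ?thesis by simp
qed

section \<open>Counting the edges by colour\<close>

lemma sum_card_colour_classes: "(\<Sum>i\<in>colours. card (colour_class i)) = card (pairs m)"
proof -
  have "card (pairs m) = card (\<Union>i\<in>colours. colour_class i)"
    by (rule arg_cong[where f = card]) (auto simp: colours_def colour_class_def)
  also have "\<dots> = (\<Sum>i\<in>colours. card (colour_class i))"
    using finite_colours finite_colour_class
    by (intro card_UN_disjoint) (auto simp: colour_class_def)
  finally show ?thesis by simp
qed

text \<open>Classes with more than \<open>x\<close> edges use up at least \<open>x + 1\<close> edges each, so a shortage of edges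
  forces classes with only \<open>x\<close> edges.\<close>

lemma many_small_classes:
  assumes "\<And>i. i \<in> colours \<Longrightarrow> x \<le> card (colour_class i)"
  shows "(x + 1) * card colours \<le> card (pairs m) + card {i \<in> colours. card (colour_class i) = x}"
proof -
  have "(x + 1) * card colours = (\<Sum>i\<in>colours. x + 1)" by simp
  also have "\<dots> \<le> (\<Sum>i\<in>colours. card (colour_class i) + of_bool (card (colour_class i) = x))"
  proof (rule sum_mono)
    fix i assume "i \<in> colours"
    then show "x + 1 \<le> card (colour_class i) + of_bool (card (colour_class i) = x)"
      using assms[of i] by auto
  qed
  also have "\<dots> = card (pairs m) + card {i \<in> colours. card (colour_class i) = x}"
    using finite_colours
    by (simp add: sum.distrib sum_card_colour_classes sum_of_bool_eq Int_def)
  finally show ?thesis .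
qed

lemma num_colours_large_classes:
  assumes "\<And>i. i \<in> colours \<Longrightarrow> x < card (colour_class i)"
  shows "2 * (int x + 1) * int (card colours) \<le> int m * (int m - 1)"
proof -
  have "{i \<in> colours. card (colour_class i) = x} = {}" using assms by fastforce
  then have "(x + 1) * card colours \<le> card (pairs m)"
    using many_small_classes[of x] assms by (metis add.right_neutral card.empty less_imp_le)
  then have "int ((x + 1) * card colours) \<le> int (card (pairs m))" by (simp only: of_nat_le_iff)
  then show ?thesis using card_pairs[of m] by (simp add: algebra_simps)
qed

end

section \<open>Comparing the two bounds\<close>

lemma bound_g_strict_mono:
  assumes "s < x" "2 * x < int m"
  shows "bound_g m s < bound_g m x"
proof -
  have "0 < (x - s) * (int m - x - s - 1)"
    using assms by (intro mult_pos_pos) linarith+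
  then show ?thesis by (simp add: bound_g_def algebra_simps)
qed

text \<open>With \<open>m = 4x\<^sup>2 + 3x - t\<close> the difference of the two bounds becomes a quadratic in the small
  number \<open>t\<close>, with linear coefficient about \<open>4x\<^sup>2\<close> and constant term about \<open>-x\<^sup>2\<close>. So it is positive
  already at \<open>t = 1\<close>, not positive for \<open>t \<le> 0\<close>, and at \<open>t = 3\<close> large enough for the count of
  small classes.\<close>

lemma bound_difference:
  assumes "int m = 4 * x\<^sup>2 + 3 * x - t"
  shows "2 * (x + 1) * bound_g m x - int m * (int m - 1)
    = t * (4 * x\<^sup>2 + 2 * x - 1 - t) - (x - 2) * (x + 1)"
  unfolding bound_g_def assms by (simp add: power2_eq_square algebra_simps)

lemma bound_difference_low:
  assumes x: "x \<ge> 2" and m: "4 * x\<^sup>2 - x \<le> int m" "int m \<le> 4 * x\<^sup>2 + 3 * x - 3"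
  shows "int m * (int m - 1) + 2 * (1 + 2 * x * (2 * x + 1)) < 2 * (x + 1) * bound_g m x"
proof -
  define t where "t = 4 * x\<^sup>2 + 3 * x - int m"
  have t: "3 \<le> t" "t \<le> 4 * x" using m by (simp_all add: t_def)
  have sq: "2 * x \<le> x\<^sup>2" using x by (simp add: power2_eq_square)
  \<comment> \<open>The quadratic in \<open>t\<close> is expanded around the end point \<open>t = 3\<close>.\<close>
  have "0 \<le> (t - 3) * (4 * x\<^sup>2 + 2 * x - 4 - t)"
    using t sq x by (intro mult_nonneg_nonneg) linarith+
  moreover have "t * (4 * x\<^sup>2 + 2 * x - 1 - t) - (x - 2) * (x + 1) - 2 * (1 + 2 * x * (2 * x + 1))
      = (t - 3) * (4 * x\<^sup>2 + 2 * x - 4 - t) + (3 * x\<^sup>2 + 3 * x - 12)"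
    by (simp add: power2_eq_square algebra_simps)
  moreover have "0 < 3 * x\<^sup>2 + 3 * x - 12" using sq x by linarith
  ultimately show ?thesis
    using bound_difference[of m x t] by (simp add: t_def)
qed

lemma bound_difference_middle:
  assumes x: "x \<ge> 2" and m: "int m \<in> {4 * x\<^sup>2 + 3 * x - 2, 4 * x\<^sup>2 + 3 * x - 1}"
  shows "int m * (int m - 1) \<le> 2 * (x + 1) * bound_g m x"
proof -
  have sq: "2 * x \<le> x\<^sup>2" using x by (simp add: power2_eq_square)
  have eq: "(x - 2) * (x + 1) = x\<^sup>2 - x - 2" by (simp add: power2_eq_square algebra_simps)
  have nonneg: "0 \<le> t * (4 * x\<^sup>2 + 2 * x - 1 - t) - (x - 2) * (x + 1)" if "t = 1 \<or> t = 2" for t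
    using that sq x unfolding eq by (elim disjE) simp_all
  from m consider "int m = 4 * x\<^sup>2 + 3 * x - 1" | "int m = 4 * x\<^sup>2 + 3 * x - 2" by blast
  then show ?thesis
  proof cases
    case 1
    from bound_difference[OF this] show ?thesis using nonneg[of 1] by simp
  next
    case 2
    from bound_difference[OF this] show ?thesis using nonneg[of 2] by simp
  qed
qed

lemma bound_difference_high:
  assumes x: "x \<ge> 2" and m: "4 * x\<^sup>2 + 3 * x \<le> int m"
  shows "2 * (x + 1) * bound_g m x \<le> int m * (int m - 1)"
proof -
  define t where "t = 4 * x\<^sup>2 + 3 * x - int m"
  have "t \<le> 0" using m by (simp add: t_def)
  then have "t * (4 * x\<^sup>2 + 2 * x - 1 - t) \<le> 0"
    using x zero_le_power2[of x] by (intro mult_nonpos_nonneg) linarith+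
  moreover have "0 \<le> (x - 2) * (x + 1)" using x by simp
  ultimately show ?thesis using bound_difference[of m x t] by (simp add: t_def)
qed

lemma le_bound_f:
  assumes "x \<ge> 0" "2 * (x + 1) * k \<le> int m * (int m - 1)"
  shows "k \<le> bound_f m x"
proof -
  have "2 * int (m choose 2) = int m * (int m - 1)"
    using card_two_subsets[of "{..<m}"] n_subsets[of "{..<m}" 2] by simp
  then have "(x + 1) * k \<le> int (m choose 2)" using assms(2) by (simp only: mult.assoc)
  then have "real_of_int ((x + 1) * k) \<le> real_of_int (int (m choose 2))"
    by (simp only: of_int_le_iff)
  then have "real_of_int k \<le> real (m choose 2) / real_of_int (x + 1)"
    using \<open>x \<ge> 0\<close> by (simp add: field_simps)
  then show ?thesis by (simp add: bound_f_def le_floor_iff)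
qed

context complete_edge_colouring
begin

lemma num_colours_le_max:
  assumes "0 \<le> x" "2 * x < int m"
  shows "int (card colours) \<le> bound_g m x
    \<or> 2 * (x + 1) * int (card colours) \<le> int m * (int m - 1)"
proof (cases "\<forall>i\<in>colours. nat x < card (colour_class i)")
  case True
  then show ?thesis using num_colours_large_classes[of "nat x"] \<open>0 \<le> x\<close> by simp
next
  case False
  then obtain i where i: "i \<in> colours" "int (card (colour_class i)) \<le> x"
    using \<open>0 \<le> x\<close> by (auto simp: not_less le_nat_iff)
  then have "int (card colours) \<le> bound_g m (int (card (colour_class i)))"
    using assms by (intro num_colours_le_bound_g) linarith+
  also have "\<dots> \<le> bound_g m x"
    using bound_g_strict_mono[of "int (card (colour_class i))" x m] i assms by fastforce
  finally show ?thesis by blast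
qed

text \<open>If \<open>g\<^sub>m(x)\<close> colours were possible, the classes with \<open>x\<close> edges would be too many for the
  supports of extremal classes, which pairwise meet in one vertex.\<close>

lemma num_colours_less_bound_g:
  assumes x: "x \<ge> 2" and m: "4 * x\<^sup>2 - x \<le> int m" "int m \<le> 4 * x\<^sup>2 + 3 * x - 3"
  shows "int (card colours) < bound_g m x"
proof (rule ccontr)
  assume "\<not> ?thesis"
  then have k: "bound_g m x \<le> int (card colours)" by simp
  define n where "n = nat x"
  have n: "int n = x" using x by (simp add: n_def)
  have sq: "2 * x \<le> x\<^sup>2" using x by (simp add: power2_eq_square)
  then have xm: "2 * x < int m" using m x by linarith
  have large: "n \<le> card (colour_class i)" if i: "i \<in> colours" for i
  proof (rule ccontr)
    assume "\<not> ?thesis"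
    then have s: "int (card (colour_class i)) < x" using n by linarith
    then have "int (card colours) \<le> bound_g m (int (card (colour_class i)))"
      using i xm by (intro num_colours_le_bound_g) linarith+
    then show False using bound_g_strict_mono[OF s xm] k by linarith
  qed
  define I where "I = {i \<in> colours. card (colour_class i) = n}"
  have extremal: "card (support i) = 2 * n" "inj_on c (around i)" if "i \<in> I" for i
  proof -
    have i: "i \<in> colours" "card (colour_class i) = n" using that by (auto simp: I_def)
    then have small: "2 * card (colour_class i) < m" using xm n by linarith
    have eq: "int (card colours) = bound_g m (int (card (colour_class i)))"
      using num_colours_le_bound_g[OF i(1) small] k i n by simp
    show "card (support i) = 2 * n" "inj_on c (around i)"
      using extremal_class[OF i(1) small eq] i by simp_all
  qed
  \<comment> \<open>Fewer than \<open>2x+3\<close> supports pass through one vertex, as \<open>(2x+3)(2x-1) = 4x\<^sup>2+4x-3\<close>.\<close>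
  have "int m - 1 < (2 * x + 3) * (2 * x - 1)"
    using m x by (simp add: power2_eq_square algebra_simps)
  then have "int (m - 1) < int ((2 * n + 1 + 2) * (2 * n - 1))"
    using n xm x by (simp add: of_nat_diff algebra_simps)
  then have "card {..<m} - 1 < (2 * n + 1 + 2) * (2 * n - 1)" by (simp only: of_nat_less_iff card_lessThan)
  then have "card I \<le> 1 + 2 * n * (2 * n + 1)"
    using extremal extremal_supports_meet_once support_subset finite_colours
    by (intro pairwise_one_point_family_bound[where S = support and X = "{..<m}"])
      (auto simp: I_def)
  then have "int (card I) \<le> int (1 + 2 * n * (2 * n + 1))" by (simp only: of_nat_le_iff)
  then have few: "int (card I) \<le> 1 + 2 * x * (2 * x + 1)" using n by (simp add: algebra_simps)
  have "int ((n + 1) * card colours) \<le> int (card (pairs m) + card I)"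
    using many_small_classes[of n] large unfolding I_def by (simp only: of_nat_le_iff)
  then have "2 * ((x + 1) * int (card colours)) \<le> int m * (int m - 1) + 2 * int (card I)"
    using card_pairs[of m] n by (simp add: distrib_right)
  moreover have "2 * (x + 1) * bound_g m x \<le> 2 * (x + 1) * int (card colours)"
    using k x by (intro mult_left_mono) simp_all
  ultimately show False
    using few bound_difference_low[OF x m] by (simp add: algebra_simps)
qed

end

section \<open>The pseudoachromatic number\<close>

lemma \<psi>_attained:
  obtains c where "complete_edge_colouring m c"
    and "\<psi> m = card (complete_edge_colouring.colours m c)"
proof -
  let ?L = "line_graph (complete_graph m)"
  have V: "verts ?L = pairs m"
    by (simp add: verts_def line_graph_def edges_def complete_graph_def pairs_def)
  then have "\<psi> m \<in> colour_numbers ?L"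
    unfolding \<psi>_def pseudoachromatic_number_def
    by (intro Max_in finite_colour_numbers colour_numbers_nonempty) (simp add: finite_pairs)
  then obtain c where c: "complete_colouring ?L c" "\<psi> m = card (c ` pairs m)"
    using V by (auto simp: colour_numbers_def)
  have adj: "e \<inter> f \<noteq> {}" if "{e, f} \<in> edges ?L" for e f
    using that by (auto simp: edges_def line_graph_def doubleton_eq_iff)
  have "complete_edge_colouring m c"
  proof
    fix i j assume "i \<in> c ` pairs m" "j \<in> c ` pairs m" "i \<noteq> j"
    then show "\<exists>e\<in>pairs m. \<exists>f\<in>pairs m. c e = i \<and> c f = j \<and> e \<inter> f \<noteq> {}"
      using c(1) adj unfolding complete_colouring_def V by meson
  qed
  then show thesis
    using that c(2) by (simp add: complete_edge_colouring.colours_def)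
qed

theorem theorem1:
  fixes x :: int and m :: nat
  assumes "x \<ge> 2"
  shows "(int m \<in> {4 * x\<^sup>2 - x .. 4 * x\<^sup>2 + 3 * x - 3} \<longrightarrow> int (\<psi> m) \<le> bound_g m x - 1)
    \<and> (int m \<in> {4 * x\<^sup>2 + 3 * x - 2, 4 * x\<^sup>2 + 3 * x - 1} \<longrightarrow> int (\<psi> m) \<le> bound_g m x)
    \<and> (int m \<in> {4 * x\<^sup>2 + 3 * x .. 4 * (x + 1)\<^sup>2 - (x + 1) - 1} \<longrightarrow> int (\<psi> m) \<le> bound_f m x)"
proof (intro conjI impI)
  obtain c where "complete_edge_colouring m c"
    and \<psi>: "\<psi> m = card (complete_edge_colouring.colours m c)"
    by (rule \<psi>_attained)
  then interpret complete_edge_colouring m c by simp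
  have sq: "2 * x \<le> x\<^sup>2" using assms by (simp add: power2_eq_square)
  show "int (\<psi> m) \<le> bound_g m x - 1" if "int m \<in> {4 * x\<^sup>2 - x .. 4 * x\<^sup>2 + 3 * x - 3}"
    using num_colours_less_bound_g[of x] assms that by (simp add: \<psi>)
  show "int (\<psi> m) \<le> bound_g m x"
    if m: "int m \<in> {4 * x\<^sup>2 + 3 * x - 2, 4 * x\<^sup>2 + 3 * x - 1}"
  proof -
    have "2 * x < int m" using m sq assms by auto
    with num_colours_le_max[of x] assms bound_difference_middle[OF assms m]
    have "int (card colours) \<le> bound_g m x
        \<or> 2 * (x + 1) * int (card colours) \<le> 2 * (x + 1) * bound_g m x"
      by linarith
    then show ?thesis using assms by (auto simp: \<psi>)
  qed
  show "int (\<psi> m) \<le> bound_f m x"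
    if m: "int m \<in> {4 * x\<^sup>2 + 3 * x .. 4 * (x + 1)\<^sup>2 - (x + 1) - 1}"
  proof -
    have low: "4 * x\<^sup>2 + 3 * x \<le> int m" using m by simp
    then have "2 * x < int m" using sq assms by linarith
    then consider "int (card colours) \<le> bound_g m x"
      | "2 * (x + 1) * int (card colours) \<le> int m * (int m - 1)"
      using num_colours_le_max[of x] assms by linarith
    then have "2 * (x + 1) * int (card colours) \<le> int m * (int m - 1)"
    proof cases
      case 1
      then have "2 * (x + 1) * int (card colours) \<le> 2 * (x + 1) * bound_g m x"
        using assms by (intro mult_left_mono) simp_all
      also have "\<dots> \<le> int m * (int m - 1)"
        by (rule bound_difference_high[OF assms low])
      finally show ?thesis .
    qed
    then show ?thesis using le_bound_f assms by (simp add: \<psi>)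
  qed
qed

end
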